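(* Let $A$ be a finite skew left brace with nilpotent additive group $(A,+)$. Then $A$ is left nilpotent if and only if the multiplicative group $(A,\circ)$ of $A$ is nilpotent.
   Context: A skew left brace is a triple $(A,+,\circ)$ where $(A,+)$ and $(A,\circ)$ are (not necessarily abelian) groups such that $a\circ(b+c)=a\circ b-a+a\circ c$ for all $a,b,c\in A$. The two groups share the same neutral element $0$. For $a,b\in A$ put $a*b=-a+a\circ b-b$. For subsets $X,Y\subseteq A$, $X*Y$ denotes the subgroup of $(A,+)$ generated by all $x*y$ with $x\in X$, $y\in Y$. The left series of $A$ is $A^1=A$, $A^{n+1}=A*A^n$ for $n\ge 1$; $A$ is left nilpotent if $A^m=0$ for some $m\ge 1$. *)

theory Defs
  imports "HOL-Algebra.Generated_Groups" "HOL-Algebra.Ring"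
begin

section \<open>Nilpotent groups\<close>

text \<open>For subsets $H$, $K$ of a group: the subgroup $[H,K]$ generated by the commutators
  $h k h^{-1} k^{-1}$ (the commutator convention of \<^const>\<open>derived\<close>).\<close>

definition commutator_subgroup :: "('a, 'b) monoid_scheme \<Rightarrow> 'a set \<Rightarrow> 'a set \<Rightarrow> 'a set" where
  "commutator_subgroup G H K =
     generate G {h \<otimes>\<^bsub>G\<^esub> k \<otimes>\<^bsub>G\<^esub> inv\<^bsub>G\<^esub> h \<otimes>\<^bsub>G\<^esub> inv\<^bsub>G\<^esub> k | h k. h \<in> H \<and> k \<in> K}"

text \<open>The index starts at 0, so \<open>lower_central_series G n\<close> is the term usually
  written $\gamma_{n+1}(G)$.\<close>

primrec lower_central_series :: "('a, 'b) monoid_scheme \<Rightarrow> nat \<Rightarrow> 'a set" where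
  "lower_central_series G 0 = carrier G"
| "lower_central_series G (Suc n) =
     commutator_subgroup G (carrier G) (lower_central_series G n)"

definition nilpotent_group :: "('a, 'b) monoid_scheme \<Rightarrow> bool" where
  "nilpotent_group G \<longleftrightarrow> group G \<and> (\<exists>n. lower_central_series G n = {\<one>\<^bsub>G\<^esub>})"

section \<open>Skew left braces\<close>

text \<open>A skew left brace $(A,+,\circ)$ is carried by a ring record, with $+$ in the field
  \<^const>\<open>add\<close> and $\circ$ in the field \<^const>\<open>mult\<close>. Hence \<open>add_monoid A\<close> is the
  additive group $(A,+)$, and the record \<open>A\<close> itself, read as a monoid record, is the
  multiplicative group $(A,\circ)$. No ring axioms are assumed; in particular $+$ need not be
  commutative.\<close>

locale skew_left_brace = mul: group A + add: group "add_monoid A" for A (structure) +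
  assumes brace_distrib:
    "\<lbrakk>a \<in> carrier A; b \<in> carrier A; c \<in> carrier A\<rbrakk>
      \<Longrightarrow> a \<otimes> (b \<oplus> c) = ((a \<otimes> b) \<oplus> (\<ominus> a)) \<oplus> (a \<otimes> c)"

text \<open>The record has separate fields for the two neutral elements, but they coincide.\<close>

lemma (in skew_left_brace) zero_eq_one: "\<zero> = \<one>"
proof -
  have z: "\<zero> \<in> carrier A"
    using add.one_closed by simp
  have m: "\<ominus> \<one> \<in> carrier A"
    using add.inv_closed[of \<one>] by (simp add: a_inv_def)
  have "\<zero> \<oplus> \<zero> = \<zero>"
    using add.l_one[of \<zero>] z by simp
  then have "\<zero> = (\<zero> \<oplus> (\<ominus> \<one>)) \<oplus> \<zero>"
    using brace_distrib[of \<one> \<zero> \<zero>] z by simp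
  also have "\<dots> = \<ominus> \<one>"
    using add.l_one[of "\<ominus> \<one>"] add.r_one[of "\<ominus> \<one>"] m by simp
  finally have "\<one> \<oplus> \<zero> = \<zero>"
    using add.r_inv[of \<one>] by (simp add: a_inv_def)
  then show ?thesis
    using add.r_one[of \<one>] by simp
qed

text \<open>$a * b = -a + a \circ b - b$.\<close>

definition brace_star :: "('a, 'b) ring_scheme \<Rightarrow> 'a \<Rightarrow> 'a \<Rightarrow> 'a" where
  "brace_star A a b = ((\<ominus>\<^bsub>A\<^esub> a) \<oplus>\<^bsub>A\<^esub> (a \<otimes>\<^bsub>A\<^esub> b)) \<oplus>\<^bsub>A\<^esub> (\<ominus>\<^bsub>A\<^esub> b)"

definition brace_star_set :: "('a, 'b) ring_scheme \<Rightarrow> 'a set \<Rightarrow> 'a set \<Rightarrow> 'a set" where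
  "brace_star_set A X Y = generate (add_monoid A) {brace_star A x y | x y. x \<in> X \<and> y \<in> Y}"

text \<open>The index starts at 0: \<open>left_series A n\<close> is $A^{n+1}$, so that quantifying over all
  \<open>n\<close> amounts to quantifying over all $A^m$ with $m \ge 1$.\<close>

primrec left_series :: "('a, 'b) ring_scheme \<Rightarrow> nat \<Rightarrow> 'a set" where
  "left_series A 0 = carrier A"
| "left_series A (Suc n) = brace_star_set A (carrier A) (left_series A n)"

definition left_nilpotent :: "('a, 'b) ring_scheme \<Rightarrow> bool" where
  "left_nilpotent A \<longleftrightarrow> (\<exists>n. left_series A n = {\<zero>\<^bsub>A\<^esub>})"

end

theory Submission
  imports Defs "HOL-Algebra.Sylow" "HOL-Algebra.Group_Action" "HOL-Algebra.Multiplicative_Group"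
begin

text \<open>Both properties are equivalent to the statement that the upper series reaches \<open>A\<close>, where
  each term consists of the elements \<open>x\<close> for which all \<open>[m, x]\<close> and all \<open>a * x\<close> lie in the preceding
  term. If \<open>A\<close> is left nilpotent, the lower central series of \<open>(A,+)\<close> refined by the left series
  shows that it does. If it does, then elements of \<open>(A,\<circ>)\<close> sink along the upper series under
  \<open>\<circ>\<close>-commutators, because \<open>a \<circ> b = a + \<lambda>\<^sub>a(b)\<close> and \<open>\<lambda>\<^sub>a(b) \<equiv> b\<close> one step further down.

  Conversely let \<open>(A,\<circ>)\<close> be nilpotent. The additive Sylow subgroups are \<open>\<lambda>\<close>-invariant, hence also
  Sylow subgroups of \<open>(A,\<circ>)\<close>, and Sylow subgroups for distinct primes commute for both operations;
  this forces them to act trivially on each other. So \<open>A\<close> acts on its Sylow \<open>p\<close>-subgroup through a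
  \<open>p\<close>-group, whose fixed points make the upper series grow until it reaches \<open>A\<close>.\<close>

section \<open>Nilpotent groups\<close>

lemma (in group) inv_cancel_left:
  assumes "a \<in> carrier G" "x \<in> carrier G"
  shows "a \<otimes> (inv a \<otimes> x) = x" "inv a \<otimes> (a \<otimes> x) = x"
  using assms by (simp_all flip: m_assoc)

lemma (in group) commutator_subgroup_is_subgroup:
  assumes "H \<subseteq> carrier G" "K \<subseteq> carrier G"
  shows "subgroup (commutator_subgroup G H K) G"
  unfolding commutator_subgroup_def using assms by (intro generate_is_subgroup) (auto intro!: m_closed inv_closed)

lemma (in group) lower_central_series_subgroup: "subgroup (lower_central_series G n) G"
proof (induction n)
  case 0
  then show ?case by (simp add: subgroup_self)
next
  case (Suc n)
  then show ?case
    using commutator_subgroup_is_subgroup[OF subset_refl subgroup.subset[OF Suc]] by simp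
qed

lemma (in group) lower_central_series_in_carrier:
  "x \<in> lower_central_series G n \<Longrightarrow> x \<in> carrier G"
  by (rule subgroup.mem_carrier[OF lower_central_series_subgroup])

lemma (in group) commutator_in_lower_central_series:
  assumes "g \<in> carrier G" "x \<in> lower_central_series G n"
  shows "g \<otimes> x \<otimes> inv g \<otimes> inv x \<in> lower_central_series G (Suc n)"
  unfolding lower_central_series.simps commutator_subgroup_def
  using assms by (intro generate.incl) auto

lemma (in group) lower_central_series_Suc_subset:
  assumes "subgroup H G"
    and "\<And>g x. g \<in> carrier G \<Longrightarrow> x \<in> lower_central_series G n \<Longrightarrow> g \<otimes> x \<otimes> inv g \<otimes> inv x \<in> H"
  shows "lower_central_series G (Suc n) \<subseteq> H"
  unfolding lower_central_series.simps commutator_subgroup_def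
  using assms by (intro generate_subgroup_incl) auto

lemma (in normal) group_hom_Mod: "group_hom G (G Mod H) (\<lambda>a. H #> a)"
  by (simp add: group_hom_def group_hom_axioms_def factorgroup_is_group is_group r_coset_hom_Mod)

lemma (in subgroup) r_coset_eq_iff:
  assumes "group G" "a \<in> carrier G" "b \<in> carrier G"
  shows "H #> a = H #> b \<longleftrightarrow> a \<otimes> inv b \<in> H"
proof -
  interpret group G by fact
  have "H #> a = H #> b" if "a \<otimes> inv b \<in> H"
    using coset_mult_inv1[OF coset_join2[OF _ subgroup_axioms that]] assms(2,3) subset by simp
  moreover have "a \<otimes> inv b \<in> H" if "H #> a = H #> b"
    using coset_join1[OF coset_mult_inv2[OF that]] assms(2,3) subset subgroup_axioms by simp
  ultimately show ?thesis by blast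
qed

text \<open>In \<open>G Mod P\<close> the order of the coset of \<open>x\<close> divides both
  \<open>card P\<close> and the index of \<open>P\<close>, so the coset is trivial.\<close>

lemma (in group) mem_normal_of_coprime:
  assumes P: "P \<lhd> G" and fin: "finite (carrier G)" and x: "x \<in> carrier G"
    and pow: "x [^] card P = \<one>" and cop: "coprime (card P) (order G div card P)"
  shows "x \<in> P"
proof -
  interpret P: normal P G by fact
  interpret h: group_hom G "G Mod P" "\<lambda>a. P #> a" by (rule P.group_hom_Mod)
  have cardP: "card P > 0"
    using P.subset P.one_closed fin by (metis card_gt_0_iff empty_iff finite_subset)
  have ord: "order (G Mod P) = order G div card P"
    using lagrange[OF P.subgroup_axioms] cardP
    by (simp add: FactGroup_def order_def) (metis nonzero_mult_div_cancel_right less_not_refl)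
  have Px: "P #> x \<in> carrier (G Mod P)" using x by simp
  have "(P #> x) [^]\<^bsub>G Mod P\<^esub> card P = \<one>\<^bsub>G Mod P\<^esub>"
    using h.hom_nat_pow[OF x, of "card P"] pow h.hom_one by simp
  then have "h.H.ord (P #> x) dvd card P" using h.H.pow_eq_id[OF Px] by simp
  moreover have "h.H.ord (P #> x) dvd order G div card P"
    using h.H.ord_dvd_group_order[OF Px] ord by simp
  ultimately have "h.H.ord (P #> x) = 1"
    using coprime_common_divisor[OF cop] by simp
  then have "P #> x = P" using h.H.ord_eq_1[OF Px] by simp
  then show ?thesis by (rule coset_join1[OF _ x P.subgroup_axioms])
qed

lemma (in group) nat_pow_card_subgroup:
  assumes "subgroup P G" "x \<in> P"
  shows "x [^] card P = \<one>"
proof -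
  interpret P: group "G\<lparr>carrier := P\<rparr>" using assms(1) subgroup_imp_group by blast
  show ?thesis
    using P.pow_order_eq_1[of x] assms(2) nat_pow_consistent[of x "card P" P]
    by (simp add: order_def)
qed

lemma (in group) conj_nat_pow:
  assumes "k \<in> carrier G" "x \<in> carrier G"
  shows "(k \<otimes> x \<otimes> inv k) [^] (n::nat) = k \<otimes> x [^] n \<otimes> inv k"
proof (induction n)
  case (Suc n)
  then show ?case using assms by (simp add: m_assoc inv_cancel_left)
qed (use assms in simp)

text \<open>Walking down the lower central series, every term lies in the normalizer \<open>K\<close> of \<open>P\<close>:
  modulo the next term, conjugation moves an element of \<open>P\<close> only inside \<open>K\<close>, where \<open>P\<close> is
  normal and hence contains all elements of order dividing \<open>card P\<close>.\<close>

lemma (in group) Hall_subgroup_normal: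
  assumes nil: "nilpotent_group G" and fin: "finite (carrier G)" and P: "subgroup P G"
    and cop: "coprime (card P) (order G div card P)"
  shows "P \<lhd> G"
proof -
  \<comment> \<open>The normalizer of \<open>P\<close>. The equivalence, in place of an implication,
    makes closure under inverses a mere substitution.\<close>
  define K where "K = {k \<in> carrier G. \<forall>x\<in>carrier G. k \<otimes> x \<otimes> inv k \<in> P \<longleftrightarrow> x \<in> P}"
  have PC: "x \<in> carrier G" if "x \<in> P" for x using subgroup.mem_carrier[OF P that] .
  have K: "subgroup K G"
  proof (rule subgroupI)
    show "K \<subseteq> carrier G" by (auto simp: K_def)
    have "\<one> \<in> K" by (auto simp: K_def)
    then show "K \<noteq> {}" by auto
  next
    fix a assume a: "a \<in> K"
    have "inv a \<otimes> x \<otimes> a \<in> P \<longleftrightarrow> x \<in> P" if "x \<in> carrier G" for x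
    proof -
      have "a \<otimes> (inv a \<otimes> x \<otimes> a) \<otimes> inv a = x"
        using a that by (simp add: K_def m_assoc inv_cancel_left)
      moreover have "inv a \<otimes> x \<otimes> a \<in> carrier G" using a that by (simp add: K_def)
      moreover have "\<forall>x\<in>carrier G. a \<otimes> x \<otimes> inv a \<in> P \<longleftrightarrow> x \<in> P"
        using a by (simp add: K_def)
      ultimately show ?thesis by metis
    qed
    then show "inv a \<in> K" using a unfolding K_def by simp
  next
    fix a b assume ab: "a \<in> K" "b \<in> K"
    have "(a \<otimes> b) \<otimes> x \<otimes> inv (a \<otimes> b) \<in> P \<longleftrightarrow> x \<in> P" if "x \<in> carrier G" for x
    proof -
      have "(a \<otimes> b) \<otimes> x \<otimes> inv (a \<otimes> b) = a \<otimes> (b \<otimes> x \<otimes> inv b) \<otimes> inv a"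
        using ab that by (simp add: K_def inv_mult_group m_assoc)
      moreover have "b \<otimes> x \<otimes> inv b \<in> carrier G" using ab that by (simp add: K_def)
      ultimately show ?thesis using ab that by (simp add: K_def)
    qed
    then show "a \<otimes> b \<in> K" using ab unfolding K_def by simp
  qed
  have PK: "P \<subseteq> K"
  proof
    fix k assume k: "k \<in> P"
    have "x \<in> P" if "x \<in> carrier G" "k \<otimes> x \<otimes> inv k \<in> P" for x
    proof -
      have "inv k \<otimes> (k \<otimes> x \<otimes> inv k) \<otimes> k \<in> P"
        using that(2) k subgroup.m_inv_closed[OF P k] by (meson P subgroup.m_closed)
      then show ?thesis using that k PC by (simp add: m_assoc inv_cancel_left)
    qed
    moreover have "k \<otimes> x \<otimes> inv k \<in> P" if "x \<in> P" for x
      using that k subgroup.m_inv_closed[OF P k] by (meson P subgroup.m_closed)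
    ultimately show "k \<in> K" using k PC unfolding K_def by blast
  qed
  interpret K: group "G\<lparr>carrier := K\<rparr>" using K subgroup_imp_group by blast
  have KP: "P \<lhd> G\<lparr>carrier := K\<rparr>"
    unfolding K.normal_inv_iff
  proof (intro conjI ballI)
    show "subgroup P (G\<lparr>carrier := K\<rparr>)" using subgroup_incl[OF P K PK] .
  next
    fix x h assume x: "x \<in> carrier (G\<lparr>carrier := K\<rparr>)" and h: "h \<in> P"
    have "x \<otimes> h \<otimes> inv x \<in> P" using x h PC by (simp add: K_def)
    then show "x \<otimes>\<^bsub>G\<lparr>carrier := K\<rparr>\<^esub> h \<otimes>\<^bsub>G\<lparr>carrier := K\<rparr>\<^esub> inv\<^bsub>G\<lparr>carrier := K\<rparr>\<^esub> x \<in> P"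
      using m_inv_consistent[OF K] x by simp
  qed
  have copK: "coprime (card P) (card K div card P)"
  proof -
    have "card P dvd card K"
      using K.lagrange[OF subgroup_incl[OF P K PK]] by (simp add: order_def) (metis dvd_triv_right)
    then obtain m where m: "card K = card P * m" ..
    have "card K dvd order G" using lagrange[OF K] by (metis dvd_triv_right)
    then obtain l where l: "order G = card K * l" ..
    have "card P \<noteq> 0" using P fin subgroup.one_closed subgroup.subset
      by (metis card_eq_0_iff empty_iff finite_subset)
    then have "card K div card P dvd order G div card P" using m l by auto
    then show ?thesis using cop coprime_divisors dvd_refl by blast
  qed
  have memP: "y \<in> P" if "y \<in> K" "y [^] card P = \<one>" for y
    using K.mem_normal_of_coprime[OF KP _ _ _ , of y] copK that finite_subset[OF subgroup.subset[OF K] fin]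
      nat_pow_consistent[of y "card P" K] by (simp add: order_def)
  have step: "lower_central_series G i \<subseteq> K" if IH: "lower_central_series G (Suc i) \<subseteq> K" for i
  proof
    have *: "k \<otimes> x \<otimes> inv k \<in> P" if k: "k \<in> lower_central_series G i" and x: "x \<in> P" for k x
    proof -
      have kc: "k \<in> carrier G" and xc: "x \<in> carrier G"
        using k x PC lower_central_series_in_carrier by auto
      \<comment> \<open>The commutator lies in the next term of the series, hence in
        \<open>K\<close>, and \<open>k \<otimes> x \<otimes> inv k\<close> is its inverse times
        \<open>x\<close>, a product inside \<open>K\<close>.\<close>
      have "x \<otimes> k \<otimes> inv x \<otimes> inv k \<in> K"
        using commutator_in_lower_central_series[OF xc k] IH by blast
      then have "inv (x \<otimes> k \<otimes> inv x \<otimes> inv k) \<otimes> x \<in> K"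
        using K PK x by (meson subgroup.m_closed subgroup.m_inv_closed subsetD)
      moreover have "inv (x \<otimes> k \<otimes> inv x \<otimes> inv k) \<otimes> x = k \<otimes> x \<otimes> inv k"
        using kc xc by (simp add: inv_mult_group m_assoc)
      ultimately have "k \<otimes> x \<otimes> inv k \<in> K" by simp
      then show ?thesis
        using memP conj_nat_pow[OF kc xc] nat_pow_card_subgroup[OF P x] kc by simp
    qed
    fix k assume k: "k \<in> lower_central_series G i"
    have kc: "k \<in> carrier G" using k lower_central_series_in_carrier by auto
    have ik: "inv k \<in> lower_central_series G i"
      using subgroup.m_inv_closed[OF lower_central_series_subgroup k] .
    have "x \<in> P" if "x \<in> carrier G" "k \<otimes> x \<otimes> inv k \<in> P" for x
      using *[OF ik that(2)] kc that(1) by (simp add: m_assoc inv_cancel_left)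
    then show "k \<in> K" using *[OF k] kc unfolding K_def by blast
  qed
  obtain n where n: "lower_central_series G n = {\<one>}" using nil unfolding nilpotent_group_def by blast
  \<comment> \<open>Descending induction on the index \<open>n - j\<close>; from
    \<open>j = n\<close> on the index is 0, and term 0 is the whole group.\<close>
  have "lower_central_series G (n - j) \<subseteq> K" for j
  proof (induction j)
    case 0
    then show ?case using n subgroup.one_closed[OF K] by simp
  next
    case (Suc j)
    show ?case
    proof (cases "j < n")
      case True
      then have "Suc (n - Suc j) = n - j" by simp
      then show ?thesis using step Suc by metis
    next
      case False
      then show ?thesis using Suc by simp
    qed
  qed
  from this[of n] have "carrier G \<subseteq> K" by simp
  then have "k \<otimes> x \<otimes> inv k \<in> P" if "k \<in> carrier G" "x \<in> P" for k x
    using that PC[OF that(2)] by (auto simp: K_def)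
  then show ?thesis unfolding normal_inv_iff using P by blast
qed

section \<open>Sylow subgroups and actions of groups of prime power order\<close>

lemma (in group) subgroup_eq_carrier_if_prime_powers:
  assumes fin: "finite (carrier G)" and H: "subgroup H G"
    and syl: "\<And>p. prime p \<Longrightarrow> \<exists>P\<subseteq>H. subgroup P G \<and> card P = p ^ multiplicity p (order G)"
  shows "H = carrier G"
proof -
  interpret H: group "G\<lparr>carrier := H\<rparr>" using H subgroup_imp_group by blast
  have H0: "card H \<noteq> 0"
    using H fin subgroup.one_closed subgroup.subset by (metis card_eq_0_iff empty_iff finite_subset)
  have G0: "order G \<noteq> 0" using fin order_gt_0_iff_finite by auto
  \<comment> \<open>By Lagrange the full power of each prime in \<open>order G\<close> divides
    \<open>card H\<close>.\<close>
  have "order G dvd card H"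
  proof (rule multiplicity_le_imp_dvd[OF G0])
    fix p :: nat assume p: "prime p"
    obtain P where P: "P \<subseteq> H" "subgroup P G" "card P = p ^ multiplicity p (order G)"
      using syl[OF p] by blast
    have "card P dvd card H"
      using H.lagrange[OF subgroup_incl[OF P(2) H P(1)]] by (simp add: order_def) (metis dvd_triv_right)
    then show "multiplicity p (order G) \<le> multiplicity p (card H)"
      using P(3) H0 p by (intro multiplicity_geI) auto
  qed
  then have "card (carrier G) \<le> card H" using H0 by (auto simp: order_def dest: dvd_imp_le)
  then show ?thesis using card_seteq[OF fin subgroup.subset[OF H]] by simp
qed

lemma (in group) Sylow_subgroup_exists:
  assumes "finite (carrier G)" "prime p"
  shows "\<exists>P. subgroup P G \<and> card P = p ^ multiplicity p (order G)"
proof -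
  obtain m where "order G = p ^ multiplicity p (order G) * m"
    using multiplicity_dvd by blast
  then show ?thesis using sylow_thm[OF assms(2) is_group _ assms(1)] by blast
qed

text \<open>\<open>Bij E\<close> contains only extensional functions, hence the restriction;
  \<open>f\<close> itself may be meaningful outside \<open>E\<close>.\<close>

lemma group_action_restrictI:
  assumes G: "group G"
    and cl: "\<And>g x. g \<in> carrier G \<Longrightarrow> x \<in> E \<Longrightarrow> f g x \<in> E"
    and one: "\<And>x. x \<in> E \<Longrightarrow> f \<one>\<^bsub>G\<^esub> x = x"
    and mult: "\<And>g h x. g \<in> carrier G \<Longrightarrow> h \<in> carrier G \<Longrightarrow> x \<in> E \<Longrightarrow> f (g \<otimes>\<^bsub>G\<^esub> h) x = f g (f h x)"
  shows "group_action G E (\<lambda>g. restrict (f g) E)"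
proof -
  interpret group G by fact
  have bij: "restrict (f g) E \<in> Bij E" if g: "g \<in> carrier G" for g
  proof -
    have "bij_betw (f g) E E"
    proof (rule bij_betw_byWitness[where f' = "f (inv\<^bsub>G\<^esub> g)"])
      show "\<forall>x\<in>E. f (inv\<^bsub>G\<^esub> g) (f g x) = x"
        using g mult[of "inv\<^bsub>G\<^esub> g" g] one by simp
      show "\<forall>x\<in>E. f g (f (inv\<^bsub>G\<^esub> g) x) = x"
        using g mult[of g "inv\<^bsub>G\<^esub> g"] one by simp
    qed (use g cl in auto)
    then show ?thesis by (auto simp: Bij_def cong: bij_betw_cong)
  qed
  have "(\<lambda>g. restrict (f g) E) \<in> hom G (BijGroup E)"
    unfolding hom_def using bij cl mult
    by (auto simp: BijGroup_def compose_def restrict_def fun_eq_iff)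
  then show ?thesis
    by (simp add: group_action_def group_hom_def group_hom_axioms_def group_BijGroup is_group)
qed

text \<open>Orbit sizes divide a power of \<open>p\<close>, so every orbit with more than one point
  has size divisible by \<open>p\<close>. If \<open>x\<close> were the only fixed point,
  \<open>card E\<close> would be 1 modulo \<open>p\<close>.\<close>

lemma (in group_action) prime_power_second_fixed_point:
  assumes p: "prime p" and P: "order G = p ^ a" and fin: "finite E" and pE: "p dvd card E"
    and x: "x \<in> E" "\<And>g. g \<in> carrier G \<Longrightarrow> \<phi> g x = x"
  shows "\<exists>y\<in>E. y \<noteq> x \<and> (\<forall>g\<in>carrier G. \<phi> g y = y)"
proof (rule ccontr)
  assume no: "\<not> ?thesis"
  let ?O = "orbits G E \<phi>"
  interpret G: group G using group_hom group_hom.axioms(1) by blast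
  have ox: "orbit G \<phi> x = {x}" using x(2) G.one_closed by (force simp: orbit_def)
  have fO: "finite ?O" using fin by (auto simp: orbits_def)
  have xO: "{x} \<in> ?O" using ox x(1) by (auto simp: orbits_def)
  have "p dvd card orb" if "orb \<in> ?O - {{x}}" for orb
  proof -
    obtain y where y: "y \<in> E" "orb = orbit G \<phi> y" using \<open>orb \<in> ?O - {{x}}\<close> by (auto simp: orbits_def)
    have "y \<noteq> x" using that y ox by auto
    then obtain g where g: "g \<in> carrier G" "\<phi> g y \<noteq> y" using no y(1) by auto
    have "card orb dvd p ^ a" using orbit_stabilizer_theorem[OF y(1)] y(2) P by (metis dvd_triv_left)
    then obtain i where i: "card orb = p ^ i" using p by (metis divides_primepow_nat)
    have sub: "{y, \<phi> g y} \<subseteq> orb" using orbit_refl[OF y(1)] g y(2) by (auto simp: orbit_def)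
    have "finite orb" using \<open>orb \<in> ?O - {{x}}\<close> fin orbits_coverture by (metis DiffD1 Union_upper finite_subset)
    then have "card orb \<ge> 2" using card_mono[OF _ sub] g(2) by simp
    then have "i \<noteq> 0" using i by (intro notI) simp
    then show ?thesis using i by simp
  qed
  then have "p dvd (\<Sum>orb\<in>?O - {{x}}. card orb)" by (intro dvd_sum) auto
  moreover have "card E = (\<Sum>orb\<in>?O. card orb)"
    using disjoint_sum[OF fin, of "\<lambda>_. 1::nat"] by simp
  then have "card E = 1 + (\<Sum>orb\<in>?O - {{x}}. card orb)"
    using sum.remove[OF fO xO, of card] by simp
  ultimately have "p dvd 1" using pE by (metis dvd_add_left_iff)
  then show False using p by simp
qed

section \<open>Commutators modulo a normal subgroup\<close>

lemma (in group) commutator_mem_iff: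
  assumes "group_hom G Q \<phi>" "\<And>a b. a \<in> carrier G \<Longrightarrow> b \<in> carrier G \<Longrightarrow> \<phi> a = \<phi> b \<longleftrightarrow> a \<otimes> inv b \<in> K"
    and "a \<in> carrier G" "b \<in> carrier G"
  shows "a \<otimes> b \<otimes> inv a \<otimes> inv b \<in> K \<longleftrightarrow> \<phi> a \<otimes>\<^bsub>Q\<^esub> \<phi> b = \<phi> b \<otimes>\<^bsub>Q\<^esub> \<phi> a"
proof -
  interpret h: group_hom G Q \<phi> by fact
  have "a \<otimes> b \<otimes> inv a \<otimes> inv b = (a \<otimes> b) \<otimes> inv (b \<otimes> a)"
    using assms(3,4) by (simp add: inv_mult_group m_assoc)
  then show ?thesis using assms(2)[of "a \<otimes> b" "b \<otimes> a"] assms(3,4) by simp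
qed

lemma (in group) commute_inv:
  assumes "m \<otimes> a = a \<otimes> m" "a \<in> carrier G" "m \<in> carrier G"
  shows "m \<otimes> inv a = inv a \<otimes> m"
proof -
  have "inv a \<otimes> (m \<otimes> a) \<otimes> inv a = inv a \<otimes> (a \<otimes> m) \<otimes> inv a" using assms(1) by simp
  then show ?thesis using assms(2,3) by (simp add: m_assoc inv_cancel_left)
qed

text \<open>Only the kernel of the projection is exported: congruences modulo \<open>H\<close>
  become equations between images and can be chained by rewriting.\<close>

lemma (in normal) quotient_map:
  obtains Q :: "'a set monoid" and \<phi> where "group_hom G Q \<phi>"
    "\<And>a b. a \<in> carrier G \<Longrightarrow> b \<in> carrier G \<Longrightarrow> \<phi> a = \<phi> b \<longleftrightarrow> a \<otimes> inv b \<in> H"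
  using group_hom_Mod r_coset_eq_iff[OF is_group] that by blast

text \<open>This is the preimage of the centre of the quotient by \<open>H\<close>, since a
  commutator lies in \<open>H\<close> exactly when the images commute.\<close>

lemma (in normal) centralizer_mod_subgroup:
  "subgroup {x \<in> carrier G. \<forall>m\<in>carrier G. m \<otimes> x \<otimes> inv m \<otimes> inv x \<in> H} G"
    (is "subgroup ?E G")
proof -
  obtain Q :: "'a set monoid" and \<phi> where hom: "group_hom G Q \<phi>"
    and eq: "\<And>a b. a \<in> carrier G \<Longrightarrow> b \<in> carrier G \<Longrightarrow> \<phi> a = \<phi> b \<longleftrightarrow> a \<otimes> inv b \<in> H"
    using quotient_map by metis
  interpret h: group_hom G Q \<phi> by fact
  have mem: "x \<in> ?E \<longleftrightarrow> x \<in> carrier G \<and>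
      (\<forall>m\<in>carrier G. \<phi> m \<otimes>\<^bsub>Q\<^esub> \<phi> x = \<phi> x \<otimes>\<^bsub>Q\<^esub> \<phi> m)" for x
    by (cases "x \<in> carrier G") (simp_all add: commutator_mem_iff[OF hom eq])
  show ?thesis
  proof (rule subgroupI)
    show "?E \<subseteq> carrier G" by blast
    have "\<one> \<in> ?E" unfolding mem by simp
    then show "?E \<noteq> {}" by blast
  next
    fix a assume "a \<in> ?E"
    then have a: "a \<in> carrier G" "\<And>m. m \<in> carrier G \<Longrightarrow> \<phi> m \<otimes>\<^bsub>Q\<^esub> \<phi> a = \<phi> a \<otimes>\<^bsub>Q\<^esub> \<phi> m"
      unfolding mem by blast+
    have "\<phi> m \<otimes>\<^bsub>Q\<^esub> \<phi> (inv a) = \<phi> (inv a) \<otimes>\<^bsub>Q\<^esub> \<phi> m" if "m \<in> carrier G" for m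
      using h.H.commute_inv[OF a(2)[OF that]] a(1) that by simp
    then show "inv a \<in> ?E" unfolding mem using a(1) by blast
  next
    fix a b assume "a \<in> ?E" "b \<in> ?E"
    then have ab: "a \<in> carrier G" "\<And>m. m \<in> carrier G \<Longrightarrow> \<phi> m \<otimes>\<^bsub>Q\<^esub> \<phi> a = \<phi> a \<otimes>\<^bsub>Q\<^esub> \<phi> m"
      "b \<in> carrier G" "\<And>m. m \<in> carrier G \<Longrightarrow> \<phi> m \<otimes>\<^bsub>Q\<^esub> \<phi> b = \<phi> b \<otimes>\<^bsub>Q\<^esub> \<phi> m"
      unfolding mem by blast+
    have "\<phi> m \<otimes>\<^bsub>Q\<^esub> \<phi> (a \<otimes> b) = \<phi> (a \<otimes> b) \<otimes>\<^bsub>Q\<^esub> \<phi> m" if m: "m \<in> carrier G" for m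
    proof -
      have "\<phi> m \<otimes>\<^bsub>Q\<^esub> \<phi> (a \<otimes> b) = (\<phi> m \<otimes>\<^bsub>Q\<^esub> \<phi> a) \<otimes>\<^bsub>Q\<^esub> \<phi> b"
        using ab(1,3) m by (simp add: h.H.m_assoc)
      also have "\<dots> = \<phi> a \<otimes>\<^bsub>Q\<^esub> (\<phi> m \<otimes>\<^bsub>Q\<^esub> \<phi> b)"
        unfolding ab(2)[OF m] using ab(1,3) m by (simp add: h.H.m_assoc)
      also have "\<dots> = \<phi> (a \<otimes> b) \<otimes>\<^bsub>Q\<^esub> \<phi> m"
        unfolding ab(4)[OF m] using ab(1,3) m by (simp add: h.H.m_assoc)
      finally show ?thesis .
    qed
    then show "a \<otimes> b \<in> ?E" unfolding mem using ab(1,3) by blast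
  qed
qed

section \<open>The upper series of a skew brace\<close>

text \<open>\<open>N\<close> is the additive group, written multiplicatively, and \<open>G\<close> the circle group;
  \<open>lam g x\<close> is \<open>\<lambda>\<^sub>g(x) = -g + g \<circ> x\<close>.\<close>

locale skew_brace_groups = group N + G: group G
  for N :: "('a, 'b) monoid_scheme" (structure) and G :: "('a, 'c) monoid_scheme" +
  assumes carrier_eq [simp]: "carrier G = carrier N"
    and distrib: "\<lbrakk>a \<in> carrier N; b \<in> carrier N; c \<in> carrier N\<rbrakk> \<Longrightarrow>
      a \<otimes>\<^bsub>G\<^esub> (b \<otimes> c) = (a \<otimes>\<^bsub>G\<^esub> b) \<otimes> inv a \<otimes> (a \<otimes>\<^bsub>G\<^esub> c)"
begin

section \<open>The lambda action\<close>

definition lam where "lam g x = inv g \<otimes> (g \<otimes>\<^bsub>G\<^esub> x)"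

lemma circ_closed [simp]: "\<lbrakk>a \<in> carrier N; b \<in> carrier N\<rbrakk> \<Longrightarrow> a \<otimes>\<^bsub>G\<^esub> b \<in> carrier N"
  using G.m_closed by simp

lemma circ_inv_closed [simp]: "a \<in> carrier N \<Longrightarrow> inv\<^bsub>G\<^esub> a \<in> carrier N"
  using G.inv_closed by simp

lemma lam_closed [simp]: "\<lbrakk>g \<in> carrier N; x \<in> carrier N\<rbrakk> \<Longrightarrow> lam g x \<in> carrier N"
  by (simp add: lam_def)

lemma circ_eq_lam: "\<lbrakk>g \<in> carrier N; x \<in> carrier N\<rbrakk> \<Longrightarrow> g \<otimes>\<^bsub>G\<^esub> x = g \<otimes> lam g x"
  by (simp add: lam_def inv_cancel_left)

text \<open>This is the brace law multiplied on the left by \<open>inv g\<close>: its middle factor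
  \<open>inv a\<close> supplies the leading inverse of the second \<open>lam\<close>.\<close>

lemma lam_mult:
  "\<lbrakk>g \<in> carrier N; x \<in> carrier N; y \<in> carrier N\<rbrakk> \<Longrightarrow> lam g (x \<otimes> y) = lam g x \<otimes> lam g y"
  by (simp add: lam_def distrib m_assoc)

lemma lam_hom: "g \<in> carrier N \<Longrightarrow> group_hom N N (lam g)"
  by (intro group_hom.intro group_hom_axioms.intro) (auto simp: hom_def lam_mult)

lemma lam_one [simp]: "g \<in> carrier N \<Longrightarrow> lam g \<one> = \<one>"
  using group_hom.hom_one[OF lam_hom] .

lemma lam_inv: "\<lbrakk>g \<in> carrier N; x \<in> carrier N\<rbrakk> \<Longrightarrow> lam g (inv x) = inv (lam g x)"
  using group_hom.hom_inv[OF lam_hom] .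

text \<open>Additivity of \<open>lam g\<close> splits \<open>lam h x\<close> into its two factors,
  the copies of \<open>inv g\<close> cancel, and associativity of the circle operation remains. With
  \<open>lam_by_one\<close>, \<open>G\<close> acts on \<open>N\<close> by automorphisms.\<close>

lemma lam_circ:
  assumes "g \<in> carrier N" "h \<in> carrier N" "x \<in> carrier N"
  shows "lam (g \<otimes>\<^bsub>G\<^esub> h) x = lam g (lam h x)"
proof -
  have "lam g (lam h x) = inv (lam g h) \<otimes> lam g (h \<otimes>\<^bsub>G\<^esub> x)"
    using assms by (simp add: lam_def[of h] lam_mult lam_inv)
  also have "\<dots> = inv (g \<otimes>\<^bsub>G\<^esub> h) \<otimes> (g \<otimes>\<^bsub>G\<^esub> (h \<otimes>\<^bsub>G\<^esub> x))"
    using assms by (simp add: lam_def inv_mult_group m_assoc inv_cancel_left)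
  also have "\<dots> = lam (g \<otimes>\<^bsub>G\<^esub> h) x"
    using assms by (simp add: lam_def G.m_assoc)
  finally show ?thesis ..
qed

lemma one_eq: "\<one>\<^bsub>G\<^esub> = \<one>"
proof -
  have o: "\<one>\<^bsub>G\<^esub> \<in> carrier N" using G.one_closed by simp
  have "\<one>\<^bsub>G\<^esub> = \<one>\<^bsub>G\<^esub> \<otimes> lam \<one>\<^bsub>G\<^esub> \<one>" unfolding lam_one[OF o] r_one[OF o] ..
  also have "\<dots> = \<one>\<^bsub>G\<^esub> \<otimes>\<^bsub>G\<^esub> \<one>" using circ_eq_lam[OF o one_closed] ..
  also have "\<dots> = \<one>" using G.l_one[of \<one>] by simp
  finally show ?thesis .
qed

lemma lam_by_one [simp]: "x \<in> carrier N \<Longrightarrow> lam \<one> x = x"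
  using G.l_one[of x] one_eq by (simp add: lam_def)

lemma lam_lam_inv [simp]:
  assumes "g \<in> carrier N" "x \<in> carrier N"
  shows "lam g (lam (inv\<^bsub>G\<^esub> g) x) = x" "lam (inv\<^bsub>G\<^esub> g) (lam g x) = x"
  using assms lam_circ[of g "inv\<^bsub>G\<^esub> g" x] lam_circ[of "inv\<^bsub>G\<^esub> g" g x]
  by (simp_all add: one_eq)

text \<open>In this form it shows that additive subgroups invariant under \<open>lam\<close> are
  closed under circle inverses.\<close>

lemma circ_inv_eq: "g \<in> carrier N \<Longrightarrow> inv\<^bsub>G\<^esub> g = inv (lam (inv\<^bsub>G\<^esub> g) g)"
  using circ_eq_lam[of "inv\<^bsub>G\<^esub> g" g] inv_equality[of "inv\<^bsub>G\<^esub> g" "lam (inv\<^bsub>G\<^esub> g) g"]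
  by (simp add: one_eq)

section \<open>Strong left ideals and the upper series\<close>

definition strong_left_ideal where
  "strong_left_ideal K \<longleftrightarrow> K \<lhd> N \<and> (\<forall>g\<in>carrier N. \<forall>x\<in>K. lam g x \<in> K)"

text \<open>The elements that are central modulo \<open>K\<close> in the semidirect product of \<open>N\<close> by \<open>G\<close>.\<close>

definition central_over where
  "central_over K = {x \<in> carrier N. (\<forall>m\<in>carrier N. m \<otimes> x \<otimes> inv m \<otimes> inv x \<in> K) \<and>
     (\<forall>g\<in>carrier N. lam g x \<otimes> inv x \<in> K)}"

text \<open>Conjugation in \<open>N\<close> and the maps \<open>lam g\<close> change an element of
  \<open>central_over K\<close> only by a factor in \<open>K\<close>, and \<open>K\<close> lies
  inside \<open>central_over K\<close>; this gives normality and invariance.\<close>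

lemma strong_left_ideal_central_over:
  assumes K: "strong_left_ideal K"
  shows "strong_left_ideal (central_over K)" "K \<subseteq> central_over K"
proof -
  interpret K: normal K N using K by (simp add: strong_left_ideal_def)
  show KC: "K \<subseteq> central_over K"
  proof
    fix x assume x: "x \<in> K"
    have "m \<otimes> x \<otimes> inv m \<otimes> inv x \<in> K" if "m \<in> carrier N" for m
      using that x K.inv_op_closed2 by (blast intro: K.m_closed K.m_inv_closed)
    moreover have "lam g x \<otimes> inv x \<in> K" if "g \<in> carrier N" for g
      using that x K by (auto simp: strong_left_ideal_def)
    ultimately show "x \<in> central_over K" using x by (auto simp: central_over_def)
  qed
  obtain Q :: "'a set monoid" and \<phi> where hom: "group_hom N Q \<phi>"
    and eq: "\<And>a b. a \<in> carrier N \<Longrightarrow> b \<in> carrier N \<Longrightarrow> \<phi> a = \<phi> b \<longleftrightarrow> a \<otimes> inv b \<in> K"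
    using K.quotient_map by metis
  interpret h: group_hom N Q \<phi> by fact
  let ?F = "{x \<in> carrier N. \<forall>g\<in>carrier N. \<phi> (lam g x) = \<phi> x}"
  have "subgroup ?F N"
  proof (rule subgroupI)
    have "\<one> \<in> ?F" by simp
    then show "?F \<noteq> {}" by blast
  qed (simp_all add: subset_iff lam_inv lam_mult)
  moreover have "central_over K =
      {x \<in> carrier N. \<forall>m\<in>carrier N. m \<otimes> x \<otimes> inv m \<otimes> inv x \<in> K} \<inter> ?F"
    by (rule Set.set_eqI) (simp add: central_over_def eq cong: conj_cong)
  ultimately have sub: "subgroup (central_over K) N"
    using subgroups_Inter_pair[OF K.centralizer_mod_subgroup] by simp
  have "x \<otimes> a \<otimes> inv x \<in> central_over K" if "x \<in> carrier N" "a \<in> central_over K" for x a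
  proof -
    have ac: "a \<in> carrier N" using that(2) by (simp add: central_over_def)
    have "x \<otimes> a \<otimes> inv x \<otimes> inv a \<in> central_over K" using that KC by (auto simp: central_over_def)
    then have "x \<otimes> a \<otimes> inv x \<otimes> inv a \<otimes> a \<in> central_over K" by (rule subgroup.m_closed[OF sub _ that(2)])
    then show ?thesis using that(1) ac by (simp add: m_assoc)
  qed
  moreover have "lam g a \<in> central_over K" if "g \<in> carrier N" "a \<in> central_over K" for g a
  proof -
    have ac: "a \<in> carrier N" using that(2) by (simp add: central_over_def)
    have "lam g a \<otimes> inv a \<in> central_over K" using that KC by (auto simp: central_over_def)
    then have "lam g a \<otimes> inv a \<otimes> a \<in> central_over K" by (rule subgroup.m_closed[OF sub _ that(2)])
    then show ?thesis using that(1) ac by (simp add: m_assoc)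
  qed
  ultimately show "strong_left_ideal (central_over K)"
    unfolding strong_left_ideal_def normal_inv_iff using sub by blast
qed

text \<open>The terms are the intersections of \<open>N\<close> with the upper central series of the
  semidirect product of \<open>N\<close> by \<open>G\<close>.\<close>

primrec upper_series where
  "upper_series 0 = {\<one>}"
| "upper_series (Suc n) = central_over (upper_series n)"

lemma strong_left_ideal_upper_series: "strong_left_ideal (upper_series n)"
proof (induction n)
  case 0
  have "{\<one>} \<lhd> N" unfolding normal_inv_iff using triv_subgroup by simp
  then show ?case by (simp add: strong_left_ideal_def)
qed (simp add: strong_left_ideal_central_over)

lemma normal_upper_series: "upper_series n \<lhd> N"
  using strong_left_ideal_upper_series strong_left_ideal_def by blast

lemma subgroup_upper_series: "subgroup (upper_series n) N"
  using normal_imp_subgroup[OF normal_upper_series] .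

lemma upper_series_mono: "m \<le> n \<Longrightarrow> upper_series m \<subseteq> upper_series n"
  using lift_Suc_mono_le[of upper_series] strong_left_ideal_central_over(2)[OF strong_left_ideal_upper_series]
  by simp

lemma upper_series_in_carrier: "x \<in> upper_series n \<Longrightarrow> x \<in> carrier N"
  by (rule subgroup.mem_carrier[OF subgroup_upper_series])

lemma upper_series_lam: "\<lbrakk>x \<in> upper_series n; g \<in> carrier N\<rbrakk> \<Longrightarrow> lam g x \<in> upper_series n"
  using strong_left_ideal_upper_series strong_left_ideal_def by blast

text \<open>Truncated subtraction is harmless: for \<open>i = 0\<close> the element \<open>x\<close>
  is \<open>\<one>\<close> and both expressions are trivial.\<close>

lemma upper_series_step:
  assumes "x \<in> upper_series i" "g \<in> carrier N"
  shows "lam g x \<otimes> inv x \<in> upper_series (i - 1)" "g \<otimes> x \<otimes> inv g \<otimes> inv x \<in> upper_series (i - 1)"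
  using assms by (cases i; simp add: central_over_def)+

section \<open>The left series compared with the upper series\<close>

primrec star_series where
  "star_series 0 = carrier N"
| "star_series (Suc n) = generate N {lam g x \<otimes> inv x | g x. g \<in> carrier N \<and> x \<in> star_series n}"

text \<open>Terms of the lower central series are fully invariant, as an endomorphism sends
  commutators to commutators.\<close>

lemma lower_central_series_lam:
  assumes "g \<in> carrier N" "x \<in> lower_central_series N n"
  shows "lam g x \<in> lower_central_series N n"
  using assms(2)
proof (induction n arbitrary: x)
  case 0
  then show ?case using assms(1) by simp
next
  case (Suc n)
  interpret h: group_hom N N "lam g" using lam_hom[OF assms(1)] .
  let ?L = "lower_central_series N (Suc n)"
  have L: "subgroup {x \<in> carrier N. lam g x \<in> ?L} N"
  proof (rule subgroupI)
    have "\<one> \<in> {x \<in> carrier N. lam g x \<in> ?L}"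
      using assms(1) subgroup.one_closed[OF lower_central_series_subgroup, of "Suc n"] by simp
    then show "{x \<in> carrier N. lam g x \<in> ?L} \<noteq> {}" by blast
  next
    fix a assume "a \<in> {x \<in> carrier N. lam g x \<in> ?L}"
    then show "inv a \<in> {x \<in> carrier N. lam g x \<in> ?L}"
      using subgroup.m_inv_closed[OF lower_central_series_subgroup, of "lam g a" "Suc n"] by simp
  next
    fix a b assume "a \<in> {x \<in> carrier N. lam g x \<in> ?L}" "b \<in> {x \<in> carrier N. lam g x \<in> ?L}"
    then show "a \<otimes> b \<in> {x \<in> carrier N. lam g x \<in> ?L}"
      using subgroup.m_closed[OF lower_central_series_subgroup, of "lam g a" "Suc n" "lam g b"] by simp
  qed auto
  have "?L \<subseteq> {x \<in> carrier N. lam g x \<in> ?L}"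
  proof (rule lower_central_series_Suc_subset[OF L])
    fix m y assume my: "m \<in> carrier N" "y \<in> lower_central_series N n"
    have yc: "y \<in> carrier N" using lower_central_series_in_carrier my(2) .
    have "lam g (m \<otimes> y \<otimes> inv m \<otimes> inv y) = lam g m \<otimes> lam g y \<otimes> inv (lam g m) \<otimes> inv (lam g y)"
      using my(1) yc by simp
    also have "\<dots> \<in> ?L"
      using commutator_in_lower_central_series Suc.IH[OF my(2)] my(1) by simp
    finally show "m \<otimes> y \<otimes> inv m \<otimes> inv y \<in> {x \<in> carrier N. lam g x \<in> ?L}"
      using my(1) yc by simp
  qed
  then show ?case using Suc.prems by blast
qed

lemma upper_series_eq_carrier_if_left_nilpotent:
  assumes M: "star_series m = {\<one>}" and nil: "nilpotent_group N"
  shows "\<exists>c. upper_series c = carrier N"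
proof -
  let ?\<gamma> = "lower_central_series N"
  have one_up: "\<one> \<in> upper_series n" for n using subgroup.one_closed[OF subgroup_upper_series] .
  \<comment> \<open>The left series is inserted between two consecutive lower central terms.
    Commutators with \<open>x\<close> fall into the next lower central term, already covered by
    \<open>upper_series j\<close>; \<open>lam g x \<otimes> inv x\<close> stays in the current term
    and moves one step down \<open>star_series\<close>. Each such step costs one more upper
    term.\<close>
  have inner: "?\<gamma> i \<inter> star_series (m - k) \<subseteq> upper_series (j + k)"
    if j: "?\<gamma> (Suc i) \<subseteq> upper_series j" and "k \<le> m" for i j k
    using \<open>k \<le> m\<close>
  proof (induction k)
    case 0
    then show ?case using M one_up by auto
  next
    case (Suc k)
    show ?case
    proof
      fix x assume x: "x \<in> ?\<gamma> i \<inter> star_series (m - Suc k)"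
      have xc: "x \<in> carrier N" using x lower_central_series_in_carrier by blast
      have "a \<otimes> x \<otimes> inv a \<otimes> inv x \<in> upper_series (j + k)" if "a \<in> carrier N" for a
        using commutator_in_lower_central_series[OF that, of x i] x j upper_series_mono[of j "j + k"] by auto
      moreover have "lam g x \<otimes> inv x \<in> upper_series (j + k)" if g: "g \<in> carrier N" for g
      proof -
        have "lam g x \<otimes> inv x \<in> ?\<gamma> i"
          using lower_central_series_lam[OF g] x lower_central_series_subgroup
          by (meson IntD1 subgroup.m_closed subgroup.m_inv_closed)
        moreover have "lam g x \<otimes> inv x \<in> star_series (Suc (m - Suc k))"
          unfolding star_series.simps using g x by (intro generate.incl) auto
        moreover have "Suc (m - Suc k) = m - k" using Suc.prems by simp
        ultimately show ?thesis using Suc by auto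
      qed
      ultimately show "x \<in> upper_series (j + Suc k)" using xc by (simp add: central_over_def)
    qed
  qed
  obtain n where n: "?\<gamma> n = {\<one>}" using nil unfolding nilpotent_group_def by blast
  have "\<exists>j. ?\<gamma> (n - d) \<subseteq> upper_series j" for d
  proof (induction d)
    case 0
    then show ?case using n one_up by auto
  next
    case (Suc d)
    then obtain j where j: "?\<gamma> (n - d) \<subseteq> upper_series j" by blast
    show ?case
    proof (cases "d < n")
      case True
      then have "Suc (n - Suc d) = n - d" by simp
      \<comment> \<open>For \<open>k = m\<close> the second factor is \<open>star_series 0\<close>,
        the whole carrier, so the full lower central term is captured.\<close>
      then have "?\<gamma> (n - Suc d) \<inter> star_series (m - m) \<subseteq> upper_series (j + m)"
        using inner[of "n - Suc d" j m] j by simp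
      then show ?thesis using lower_central_series_in_carrier by fastforce
    next
      case False
      then show ?thesis using j by auto
    qed
  qed
  then obtain j where "?\<gamma> (n - n) \<subseteq> upper_series j" by blast
  then show ?thesis using subgroup.subset[OF subgroup_upper_series] by auto
qed

lemma left_nilpotent_if_upper_series_eq_carrier:
  assumes "upper_series c = carrier N"
  shows "star_series c = {\<one>}"
proof -
  have "star_series k \<subseteq> upper_series (c - k)" for k
  proof (induction k)
    case 0
    then show ?case using assms by simp
  next
    case (Suc k)
    have "lam g x \<otimes> inv x \<in> upper_series (c - Suc k)" if "g \<in> carrier N" "x \<in> star_series k" for g x
      using upper_series_step(1)[of x "c - k" g] Suc that by auto
    then show ?case unfolding star_series.simps
      by (intro generate_subgroup_incl subgroup_upper_series) auto
  qed
  from this[of c] have "star_series c \<subseteq> {\<one>}" by simp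
  moreover have "\<one> \<in> star_series c" by (cases c) (auto intro: generate.one)
  ultimately show ?thesis by blast
qed

text \<open>The \<open>n\<close>-th term of the lower central series of \<open>G\<close> lies in the set \<open>D n\<close> of elements that
  have depth \<open>n\<close> in the upper series and whose \<open>lam\<close>-action lowers the upper series by
  \<open>n + 1\<close> steps (truncated subtraction is harmless as term 0 is trivial).\<close>

lemma nilpotent_circ_if_upper_series_eq_carrier:
  assumes c: "upper_series c = carrier N"
  shows "nilpotent_group G"
proof -
  let ?C = upper_series
  define D where "D n = {h \<in> ?C (c - n). \<forall>i. \<forall>x\<in>?C i. lam h x \<otimes> inv x \<in> ?C (i - Suc n)}" for n
  have DC: "h \<in> carrier N" if "h \<in> D n" for h n
    using that upper_series_in_carrier by (auto simp: D_def)
  have mult: "a \<otimes> b \<in> ?C i" if "a \<in> ?C i" "b \<in> ?C i" for a b i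
    using subgroup.m_closed[OF subgroup_upper_series that] .
  have inv: "inv a \<in> ?C i" if "a \<in> ?C i" for a i
    using subgroup.m_inv_closed[OF subgroup_upper_series that] .
  have D: "subgroup (D n) G" for n
  proof (rule G.subgroupI)
    show "D n \<subseteq> carrier G" using DC by auto
    have "\<one> \<in> D n"
      using subgroup.one_closed[OF subgroup_upper_series] upper_series_in_carrier by (simp add: D_def)
    then show "D n \<noteq> {}" by blast
  next
    fix a assume a: "a \<in> D n"
    have ac: "a \<in> carrier N" using DC[OF a] .
    have "inv (lam (inv\<^bsub>G\<^esub> a) a) \<in> ?C (c - n)"
      using a ac by (intro inv upper_series_lam) (simp_all add: D_def)
    then have "inv\<^bsub>G\<^esub> a \<in> ?C (c - n)" unfolding circ_inv_eq[OF ac, symmetric] .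
    moreover have "lam (inv\<^bsub>G\<^esub> a) x \<otimes> inv x \<in> ?C (i - Suc n)" if x: "x \<in> ?C i" for i x
    proof -
      \<comment> \<open>Writing \<open>x\<close> as \<open>lam a z\<close> turns the expression for
        the circle inverse of \<open>a\<close> into the additive inverse of
        \<open>lam a z \<otimes> inv z\<close>.\<close>
      define z where "z = lam (inv\<^bsub>G\<^esub> a) x"
      have z: "z \<in> ?C i" using upper_series_lam[OF x] ac by (simp add: z_def)
      have xz: "x = lam a z" using ac upper_series_in_carrier[OF x] by (simp add: z_def)
      have "inv (lam a z \<otimes> inv z) \<in> ?C (i - Suc n)" using a z inv by (simp add: D_def)
      then show ?thesis
        using ac upper_series_in_carrier[OF z] unfolding z_def[symmetric] xz by (simp add: inv_mult_group)
    qed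
    ultimately show "inv\<^bsub>G\<^esub> a \<in> D n" by (simp add: D_def)
  next
    fix a b assume ab: "a \<in> D n" "b \<in> D n"
    have abc: "a \<in> carrier N" "b \<in> carrier N" using DC ab by auto
    have "a \<otimes>\<^bsub>G\<^esub> b \<in> ?C (c - n)"
      unfolding circ_eq_lam[OF abc] using ab abc upper_series_lam mult by (simp add: D_def)
    moreover have "lam (a \<otimes>\<^bsub>G\<^esub> b) x \<otimes> inv x \<in> ?C (i - Suc n)" if x: "x \<in> ?C i" for i x
    proof -
      have xc: "x \<in> carrier N" using upper_series_in_carrier[OF x] .
      have "lam a (lam b x) \<otimes> inv (lam b x) \<in> ?C (i - Suc n)"
        using ab(1) upper_series_lam[OF x abc(2)] by (simp add: D_def)
      moreover have "lam b x \<otimes> inv x \<in> ?C (i - Suc n)" using ab(2) x by (simp add: D_def)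
      ultimately have "lam a (lam b x) \<otimes> inv (lam b x) \<otimes> (lam b x \<otimes> inv x) \<in> ?C (i - Suc n)"
        by (rule mult)
      then show ?thesis using abc xc by (simp add: lam_circ m_assoc inv_cancel_left)
    qed
    ultimately show "a \<otimes>\<^bsub>G\<^esub> b \<in> D n" by (simp add: D_def)
  qed
  have comm: "g \<otimes>\<^bsub>G\<^esub> h \<otimes>\<^bsub>G\<^esub> inv\<^bsub>G\<^esub> g \<otimes>\<^bsub>G\<^esub> inv\<^bsub>G\<^esub> h \<in> D (Suc n)"
    if g: "g \<in> carrier N" and h: "h \<in> D n" for g h n
  proof -
    define k where "k = g \<otimes>\<^bsub>G\<^esub> h \<otimes>\<^bsub>G\<^esub> inv\<^bsub>G\<^esub> g \<otimes>\<^bsub>G\<^esub> inv\<^bsub>G\<^esub> h"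
    define w where "w = h \<otimes>\<^bsub>G\<^esub> g"
    have hc: "h \<in> carrier N" using DC[OF h] .
    have kc: "k \<in> carrier N" and wc: "w \<in> carrier N" using g hc by (simp_all add: k_def w_def)
    have "k = g \<otimes>\<^bsub>G\<^esub> h \<otimes>\<^bsub>G\<^esub> inv\<^bsub>G\<^esub> w"
      using g hc by (simp add: k_def w_def G.inv_mult_group G.m_assoc)
    then have kw: "k \<otimes>\<^bsub>G\<^esub> w = g \<otimes>\<^bsub>G\<^esub> h" using g hc wc by (simp add: G.m_assoc)
    \<comment> \<open>With \<open>x = lam w z\<close>, \<open>lam k x\<close> is
      \<open>lam g (lam h z)\<close>, whereas \<open>x\<close> is \<open>lam h (lam g z)\<close>.
      They expand to \<open>lam g u \<otimes> (y \<otimes> z)\<close> and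
      \<open>lam h y \<otimes> (u \<otimes> z)\<close>. Modulo the target term,
      \<open>lam g u\<close> is \<open>u\<close>, \<open>lam h y\<close> is \<open>y\<close>, and
      \<open>u\<close> and \<open>y\<close> commute.\<close>
    have lam_k: "lam k x \<otimes> inv x \<in> ?C (i - Suc (Suc n))" if x: "x \<in> ?C i" for i x
    proof -
      obtain Q :: "'a set monoid" and \<phi> where hom: "group_hom N Q \<phi>"
        and eq: "\<And>a b. a \<in> carrier N \<Longrightarrow> b \<in> carrier N \<Longrightarrow> \<phi> a = \<phi> b \<longleftrightarrow> a \<otimes> inv b \<in> ?C (i - Suc (Suc n))"
        using normal.quotient_map[OF normal_upper_series] by metis
      interpret q: group_hom N Q \<phi> by fact
      define z where "z = lam (inv\<^bsub>G\<^esub> w) x"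
      have z: "z \<in> ?C i" using upper_series_lam[OF x] wc by (simp add: z_def)
      have zc: "z \<in> carrier N" using upper_series_in_carrier[OF z] .
      have xz: "x = lam w z" using wc upper_series_in_carrier[OF x] by (simp add: z_def)
      define u where "u = lam h z \<otimes> inv z"
      define y where "y = lam g z \<otimes> inv z"
      have u: "u \<in> ?C (i - Suc n)" using h z by (simp add: D_def u_def)
      have y: "y \<in> ?C (i - 1)" using upper_series_step(1)[OF z g] by (simp add: y_def)
      have uc: "u \<in> carrier N" and yc: "y \<in> carrier N" using u y upper_series_in_carrier by auto
      have hz: "lam h z = u \<otimes> z" and gz: "lam g z = y \<otimes> z"
        using g hc zc by (simp_all add: u_def y_def m_assoc)
      have pred: "i - Suc n - 1 = i - Suc (Suc n)" "i - 1 - Suc n = i - Suc (Suc n)" by simp_all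
      have gu: "\<phi> (lam g u) = \<phi> u"
        using upper_series_step(1)[OF u g] eq g uc pred by simp
      have hy: "\<phi> (lam h y) = \<phi> y"
      proof -
        have "lam h y \<otimes> inv y \<in> ?C (i - 1 - Suc n)" using h y unfolding D_def by blast
        then show ?thesis using eq hc yc pred(2) by simp
      qed
      have uy: "\<phi> y \<otimes>\<^bsub>Q\<^esub> \<phi> u = \<phi> u \<otimes>\<^bsub>Q\<^esub> \<phi> y"
        using upper_series_step(2)[OF u yc] commutator_mem_iff[OF hom eq yc uc] unfolding pred(1) by blast
      have "lam k x = lam (g \<otimes>\<^bsub>G\<^esub> h) z"
        unfolding xz kw[symmetric] using lam_circ[OF kc wc zc] by simp
      also have "\<dots> = lam g u \<otimes> (y \<otimes> z)"
        using lam_circ[OF g hc zc] hz gz lam_mult[OF g uc zc] by simp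
      finally have 1: "lam k x = lam g u \<otimes> (y \<otimes> z)" .
      have "x = lam h y \<otimes> (u \<otimes> z)"
        unfolding xz w_def lam_circ[OF hc g zc] gz lam_mult[OF hc yc zc] hz ..
      then have "\<phi> x = \<phi> y \<otimes>\<^bsub>Q\<^esub> \<phi> u \<otimes>\<^bsub>Q\<^esub> \<phi> z"
        using hy hc uc yc zc by (simp add: q.H.m_assoc)
      also have "\<dots> = \<phi> (lam k x)"
        unfolding uy 1 using gu g uc yc zc by (simp add: q.H.m_assoc)
      finally show ?thesis using eq[of "lam k x" x] kc upper_series_in_carrier[OF x] by simp
    qed
    \<comment> \<open>Modulo the target term \<open>lam g h\<close>, \<open>lam h g\<close> and
      \<open>lam k w\<close> are \<open>h\<close>, \<open>g\<close> and \<open>w\<close>, so the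
      three circle products become products in \<open>N\<close>. As \<open>g\<close> and
      \<open>h\<close> commute there, \<open>k \<otimes> w\<close> is congruent to
      \<open>w\<close>.\<close>
    have "k \<in> ?C (c - Suc n)"
    proof -
      obtain Q :: "'a set monoid" and \<phi> where hom: "group_hom N Q \<phi>"
        and eq: "\<And>a b. a \<in> carrier N \<Longrightarrow> b \<in> carrier N \<Longrightarrow> \<phi> a = \<phi> b \<longleftrightarrow> a \<otimes> inv b \<in> ?C (c - Suc n)"
        using normal.quotient_map[OF normal_upper_series] by metis
      interpret q: group_hom N Q \<phi> by fact
      have hC: "h \<in> ?C (c - n)" using h by (simp add: D_def)
      have pred: "c - n - 1 = c - Suc n" by simp
      have gh: "\<phi> (lam g h) = \<phi> h"
        using upper_series_step(1)[OF hC g] eq g hc pred by simp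
      have hg: "\<phi> (lam h g) = \<phi> g"
      proof -
        have "lam h g \<otimes> inv g \<in> ?C (c - Suc n)" using h g c unfolding D_def by blast
        then show ?thesis using eq g hc by simp
      qed
      have comm: "\<phi> g \<otimes>\<^bsub>Q\<^esub> \<phi> h = \<phi> h \<otimes>\<^bsub>Q\<^esub> \<phi> g"
        using upper_series_step(2)[OF hC g] commutator_mem_iff[OF hom eq g hc] unfolding pred by blast
      have kw': "\<phi> (lam k w) = \<phi> w"
      proof -
        have "lam k w \<otimes> inv w \<in> ?C (c - Suc (Suc n))" using lam_k[of w c] wc c by simp
        then have "lam k w \<otimes> inv w \<in> ?C (c - Suc n)"
          by (rule subsetD[OF upper_series_mono, rotated]) arith
        then show ?thesis using eq wc kc by simp
      qed
      have w: "\<phi> w = \<phi> h \<otimes>\<^bsub>Q\<^esub> \<phi> g"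
        unfolding w_def circ_eq_lam[OF hc g] using g hc hg by simp
      have "\<phi> k \<otimes>\<^bsub>Q\<^esub> \<phi> w = \<phi> (k \<otimes>\<^bsub>G\<^esub> w)"
        unfolding circ_eq_lam[OF kc wc] using kc wc kw' by simp
      also have "\<dots> = \<phi> w"
        unfolding kw circ_eq_lam[OF g hc] w comm[symmetric] using g hc gh by simp
      finally have "\<phi> k = \<phi> \<one>" using kc wc by simp
      then show ?thesis using eq[of k \<one>] kc by simp
    qed
    then show ?thesis using lam_k by (simp add: D_def k_def)
  qed
  have "lower_central_series G n \<subseteq> D n" for n
  proof (induction n)
    case 0
    \<comment> \<open>\<open>D 0\<close> is everything, since every \<open>lam h\<close> lowers the
      upper series by at least one step.\<close>
    then show ?case using upper_series_step(1) c by (auto simp: D_def)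
  next
    case (Suc n)
    then show ?case
      using comm by (intro G.lower_central_series_Suc_subset[OF D]) auto
  qed
  from this[of c] have "lower_central_series G c \<subseteq> {\<one>\<^bsub>G\<^esub>}" by (auto simp: D_def one_eq)
  moreover have "\<one>\<^bsub>G\<^esub> \<in> lower_central_series G c"
    using subgroup.one_closed[OF G.lower_central_series_subgroup] .
  ultimately show ?thesis unfolding nilpotent_group_def using G.is_group by blast
qed

end

section \<open>Sylow subgroups\<close>

lemma coprime_prime_power_part:
  assumes "prime (p::nat)" "n \<noteq> 0"
  shows "coprime (p ^ multiplicity p n) (n div p ^ multiplicity p n)"
proof -
  have "\<not> p dvd n div p ^ multiplicity p n"
    using assms multiplicity_decompose not_prime_unit by blast
  then show ?thesis using assms(1) prime_imp_coprime by (auto simp: coprime_power_left_iff)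
qed

text \<open>The order of \<open>P\<close> is coprime to its index, so \<open>P\<close> is a Hall
  subgroup. The second claim recognizes elements of \<open>P\<close> by their orders, which makes
  \<open>P\<close> invariant under automorphisms.\<close>

lemma (in group) Sylow_subgroup_normal:
  assumes "nilpotent_group G" and fin: "finite (carrier G)" and p: "prime p" and P: "subgroup P G"
    and card: "card P = p ^ multiplicity p (order G)"
  shows "P \<lhd> G" "\<lbrakk>x \<in> carrier G; x [^] card P = \<one>\<rbrakk> \<Longrightarrow> x \<in> P"
proof -
  have "order G \<noteq> 0" using fin order_gt_0_iff_finite by auto
  then have cop: "coprime (card P) (order G div card P)"
    unfolding card using coprime_prime_power_part[OF p] by blast
  show nP: "P \<lhd> G" by (rule Hall_subgroup_normal[OF assms(1) fin P cop])
  show "x \<in> P" if "x \<in> carrier G" "x [^] card P = \<one>"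
    by (rule mem_normal_of_coprime[OF nP fin that cop])
qed

lemma (in group) coprime_card_Int:
  assumes "subgroup H G" "subgroup K G" "coprime (card H) (card K)" "x \<in> H" "x \<in> K"
  shows "x = \<one>"
proof -
  have x: "x \<in> carrier G" using subgroup.mem_carrier assms(1,4) .
  have "ord x dvd card H" "ord x dvd card K"
    using nat_pow_card_subgroup assms pow_eq_id[OF x] by blast+
  then have "ord x = 1" using coprime_common_divisor[OF assms(3)] by simp
  then show ?thesis using ord_eq_1[OF x] by simp
qed

text \<open>The commutator of \<open>a\<close> and \<open>b\<close> lies in both subgroups, whose
  intersection is trivial.\<close>

lemma (in group) normal_coprime_commute:
  assumes H: "H \<lhd> G" and K: "K \<lhd> G" and "coprime (card H) (card K)" and a: "a \<in> H" and b: "b \<in> K"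
  shows "a \<otimes> b = b \<otimes> a"
proof -
  interpret H: normal H G by fact
  interpret K: normal K G by fact
  have c: "a \<in> carrier G" "b \<in> carrier G" using a b by simp_all
  have "a \<otimes> b \<otimes> inv a \<otimes> inv b \<in> K"
    using K.m_closed[OF K.inv_op_closed2[OF c(1) b] K.m_inv_closed[OF b]] .
  moreover have "a \<otimes> (b \<otimes> inv a \<otimes> inv b) \<in> H"
    using H.m_closed[OF a H.inv_op_closed2[OF c(2) H.m_inv_closed[OF a]]] .
  then have "a \<otimes> b \<otimes> inv a \<otimes> inv b \<in> H" using c by (simp add: m_assoc)
  ultimately have "a \<otimes> b \<otimes> inv a \<otimes> inv b = \<one>"
    using coprime_card_Int[OF H.subgroup_axioms K.subgroup_axioms assms(3)] by blast
  then have "(a \<otimes> b) \<otimes> inv (b \<otimes> a) = \<one>" using c by (simp add: inv_mult_group m_assoc)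
  then show ?thesis using c by (metis inv_closed inv_equality inv_inv m_closed)
qed

text \<open>The first lower central term inside \<open>K\<close> is not term 0, as \<open>K\<close>
  is proper. The term before it has an element outside \<open>K\<close>, whose commutators fall into
  \<open>K\<close>.\<close>

lemma (in group) nilpotent_center_mod:
  assumes "nilpotent_group G" and K: "subgroup K G" and "K \<noteq> carrier G"
  shows "\<exists>x\<in>carrier G - K. \<forall>m\<in>carrier G. m \<otimes> x \<otimes> inv m \<otimes> inv x \<in> K"
proof -
  obtain n where "lower_central_series G n = {\<one>}"
    using assms(1) unfolding nilpotent_group_def by blast
  then have n: "lower_central_series G n \<subseteq> K" using subgroup.one_closed[OF K] by simp
  define j where "j = (LEAST n. lower_central_series G n \<subseteq> K)"
  have j: "lower_central_series G j \<subseteq> K" 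
    unfolding j_def by (rule LeastI[where P = "\<lambda>n. lower_central_series G n \<subseteq> K", OF n])
  have "j \<noteq> 0" using j subgroup.subset[OF K] assms(3) by (intro notI) auto
  then obtain i where i: "j = Suc i" by (cases j) auto
  have "\<not> lower_central_series G i \<subseteq> K"
    using not_less_Least[of i "\<lambda>n. lower_central_series G n \<subseteq> K"] i by (simp add: j_def)
  then obtain x where x: "x \<in> lower_central_series G i" "x \<notin> K" by blast
  have "m \<otimes> x \<otimes> inv m \<otimes> inv x \<in> K" if "m \<in> carrier G" for m
    using commutator_in_lower_central_series[OF that x(1)] j i by blast
  then show ?thesis using x lower_central_series_in_carrier by blast
qed

section \<open>Sylow subgroups of both groups, and growth of the upper series\<close>

context skew_brace_groups
begin

lemma order_circ: "order G = order N"
  by (simp add: order_def)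

text \<open>Since \<open>N\<close> and \<open>G\<close> have equal order, this turns an additive
  Sylow subgroup that is a strong left ideal into a Sylow subgroup of \<open>G\<close>.\<close>

lemma strong_left_ideal_circ_subgroup:
  assumes "strong_left_ideal K"
  shows "subgroup K G"
proof (rule G.subgroupI)
  have K: "subgroup K N" and lam: "\<And>g x. g \<in> carrier N \<Longrightarrow> x \<in> K \<Longrightarrow> lam g x \<in> K"
    using assms normal_imp_subgroup by (auto simp: strong_left_ideal_def)
  show "K \<subseteq> carrier G" using subgroup.subset[OF K] by simp
  show "K \<noteq> {}" using subgroup.one_closed[OF K] by blast
  fix a assume a: "a \<in> K"
  have ac: "a \<in> carrier N" using subgroup.mem_carrier[OF K a] .
  have "inv (lam (inv\<^bsub>G\<^esub> a) a) \<in> K"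
    using a ac by (intro subgroup.m_inv_closed[OF K] lam) simp_all
  then show "inv\<^bsub>G\<^esub> a \<in> K" unfolding circ_inv_eq[OF ac, symmetric] .
  fix b assume b: "b \<in> K"
  have bc: "b \<in> carrier N" using subgroup.mem_carrier[OF K b] .
  show "a \<otimes>\<^bsub>G\<^esub> b \<in> K"
    unfolding circ_eq_lam[OF ac bc] using a b ac by (intro subgroup.m_closed[OF K] lam)
qed

lemma lam_nat_pow:
  assumes "g \<in> carrier N" "x \<in> carrier N"
  shows "lam g (x [^] (n::nat)) = lam g x [^] n"
proof -
  interpret h: group_hom N N "lam g" using lam_hom[OF assms(1)] .
  show ?thesis using h.hom_nat_pow[OF assms(2)] .
qed

text \<open>Each \<open>lam g\<close> preserves the equation \<open>x [^] card P = \<one>\<close>,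
  which characterizes \<open>P\<close> because \<open>N\<close> is nilpotent.\<close>

lemma Sylow_strong_left_ideal:
  assumes nil: "nilpotent_group N" and fin: "finite (carrier N)" and p: "prime p" and P: "subgroup P N"
    and card: "card P = p ^ multiplicity p (order N)"
  shows "strong_left_ideal P"
proof -
  have "lam g x \<in> P" if "g \<in> carrier N" "x \<in> P" for g x
  proof -
    have x: "x \<in> carrier N" using subgroup.mem_carrier[OF P that(2)] .
    have "lam g x [^] card P = \<one>"
      using lam_nat_pow[OF that(1) x, of "card P"] nat_pow_card_subgroup[OF P that(2)] that(1) by simp
    then show ?thesis using Sylow_subgroup_normal(2)[OF nil fin p P card] that(1) x by simp
  qed
  then show ?thesis
    unfolding strong_left_ideal_def using Sylow_subgroup_normal(1)[OF nil fin p P card] by blast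
qed

text \<open>Elements of the two Sylow subgroups commute for both operations, so that
  \<open>a + lam a b = lam b a + b\<close>; the two sides have the same component in each subgroup.\<close>

lemma lam_trivial_between_Sylow:
  assumes nilN: "nilpotent_group N" and nilG: "nilpotent_group G" and fin: "finite (carrier N)"
    and p: "prime p" "subgroup P N" "card P = p ^ multiplicity p (order N)"
    and q: "prime q" "subgroup Q N" "card Q = q ^ multiplicity q (order N)"
    and pq: "p \<noteq> q" and a: "a \<in> P" and b: "b \<in> Q"
  shows "lam a b = b"
proof -
  have c: "a \<in> carrier N" "b \<in> carrier N"
    using subgroup.mem_carrier[OF p(2) a] subgroup.mem_carrier[OF q(2) b] .
  have cop: "coprime (card P) (card Q)"
    unfolding p(3) q(3) using primes_coprime[OF p(1) q(1) pq]
    by (simp add: coprime_power_left_iff coprime_power_right_iff)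
  have sP: "strong_left_ideal P" and sQ: "strong_left_ideal Q"
    using Sylow_strong_left_ideal[OF nilN fin p] Sylow_strong_left_ideal[OF nilN fin q] .
  have finG: "finite (carrier G)" using fin by simp
  have nP: "P \<lhd> G" "Q \<lhd> G"
    using G.Sylow_subgroup_normal(1)[OF nilG finG, unfolded order_circ, OF p(1) _ p(3)]
      G.Sylow_subgroup_normal(1)[OF nilG finG, unfolded order_circ, OF q(1) _ q(3)]
      strong_left_ideal_circ_subgroup[OF sP] strong_left_ideal_circ_subgroup[OF sQ] by simp_all
  have ab: "lam a b \<in> Q" and ba: "lam b a \<in> P"
    using sP sQ a b c by (auto simp: strong_left_ideal_def)
  have cc: "lam a b \<in> carrier N" "lam b a \<in> carrier N" using c by simp_all
  have "a \<otimes> lam a b = b \<otimes> lam b a"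
    using G.normal_coprime_commute[OF nP cop a b] c by (simp add: circ_eq_lam)
  also have "\<dots> = lam b a \<otimes> b"
    using normal_coprime_commute[OF _ _ cop ba b] sP sQ by (simp add: strong_left_ideal_def)
  finally have *: "a \<otimes> lam a b = lam b a \<otimes> b" .
  have "inv (lam b a) \<otimes> a = inv (lam b a) \<otimes> (a \<otimes> lam a b) \<otimes> inv (lam a b)"
    using c cc by (simp add: m_assoc)
  also have "\<dots> = b \<otimes> inv (lam a b)" unfolding * using c cc by (simp add: m_assoc inv_cancel_left)
  finally have "inv (lam b a) \<otimes> a = b \<otimes> inv (lam a b)" .
  moreover have "inv (lam b a) \<otimes> a \<in> P" using subgroup.m_closed[OF p(2) subgroup.m_inv_closed[OF p(2) ba] a] .
  moreover have "b \<otimes> inv (lam a b) \<in> Q" using subgroup.m_closed[OF q(2) b subgroup.m_inv_closed[OF q(2) ab]] .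
  ultimately have "b \<otimes> inv (lam a b) = \<one>"
    using coprime_card_Int[OF p(2) q(2) cop] by simp
  then show ?thesis using c cc by (metis inv_equality inv_inv inv_closed)
qed

lemma lam_image_coset:
  assumes U: "U \<subseteq> carrier N" and lamU: "\<And>g x. g \<in> carrier N \<Longrightarrow> x \<in> U \<Longrightarrow> lam g x \<in> U"
    and g: "g \<in> carrier N" and x: "x \<in> carrier N"
  shows "lam g ` (U #> x) = U #> lam g x"
proof
  show "lam g ` (U #> x) \<subseteq> U #> lam g x"
    using U lamU g x by (auto simp: r_coset_def lam_mult subset_iff)
  show "U #> lam g x \<subseteq> lam g ` (U #> x)"
  proof
    fix y assume "y \<in> U #> lam g x"
    then obtain u where u: "u \<in> U" "y = u \<otimes> lam g x" by (auto simp: r_coset_def)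
    have "y = lam g (lam (inv\<^bsub>G\<^esub> g) u \<otimes> x)" using u U g x by (simp add: lam_mult subset_iff)
    moreover have "lam (inv\<^bsub>G\<^esub> g) u \<otimes> x \<in> U #> x" using lamU[OF _ u(1)] g by (auto simp: r_coset_def)
    ultimately show "y \<in> lam g ` (U #> x)" by blast
  qed
qed

text \<open>The \<open>p\<close>-group \<open>P\<close> acts on the cosets of \<open>V \<inter> K\<close> in the \<open>p\<close>-group \<open>V\<close>, fixing the trivial coset.\<close>

lemma prime_power_fixed_coset:
  assumes p: "prime p" and P: "subgroup P G" "card P = p ^ a"
    and V: "subgroup V N" "card V = p ^ b" and lamV: "\<And>g x. g \<in> carrier N \<Longrightarrow> x \<in> V \<Longrightarrow> lam g x \<in> V"
    and K: "strong_left_ideal K" and VK: "\<not> V \<subseteq> K"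
  shows "\<exists>x\<in>V - K. \<forall>g\<in>P. lam g x \<otimes> inv x \<in> K"
proof -
  define U where "U = V \<inter> K"
  have sK: "subgroup K N" using K normal_imp_subgroup unfolding strong_left_ideal_def by blast
  have U: "subgroup U N" unfolding U_def using V(1) sK by (rule subgroups_Inter_pair)
  have UV: "U \<subseteq> V" by (simp add: U_def)
  have lamU: "lam g x \<in> U" if "g \<in> carrier N" "x \<in> U" for g x
    using that lamV K by (auto simp: U_def strong_left_ideal_def)
  have VC: "V \<subseteq> carrier N" and UC: "U \<subseteq> carrier N" using V(1) U subgroup.subset by auto
  have PC: "g \<in> carrier N" if "g \<in> P" for g using subgroup.mem_carrier[OF P(1) that] by simp
  interpret V: group "N\<lparr>carrier := V\<rparr>" using V(1) subgroup_imp_group by blast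
  define X where "X = (\<lambda>x. U #> x) ` V"
  have X: "X = rcosets\<^bsub>N\<lparr>carrier := V\<rparr>\<^esub> U"
    by (auto simp: X_def RCOSETS_def r_coset_def)
  have cardX: "card X * card U = p ^ b"
    using V.lagrange[OF subgroup_incl[OF U V(1) UV]] V(2) unfolding X by (simp add: order_def)
  have finV: "finite V" using V(2) p by (metis card.infinite power_not_zero not_prime_0)
  \<comment> \<open>More than one coset exists, and their number divides a power of
    \<open>p\<close>; so it is divisible by \<open>p\<close>, as the fixed point argument
    requires.\<close>
  have "card U < card V" using VK UV finV by (intro psubset_card_mono) (auto simp: U_def)
  then have "card X \<noteq> 1" using cardX V(2) by auto
  moreover obtain j where "card X = p ^ j"
    using cardX p divides_primepow_nat by (metis dvd_triv_left)
  ultimately have pX: "p dvd card X" by (cases j) auto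
  let ?P = "G\<lparr>carrier := P\<rparr>"
  have img: "lam g ` (U #> x) = U #> lam g x" if "g \<in> carrier N" "x \<in> V" for g x
    using lam_image_coset[OF UC lamU] that VC by blast
  interpret act: group_action ?P X "\<lambda>g. restrict ((`) (lam g)) X"
  proof (rule group_action_restrictI)
    show "group ?P" using G.subgroup_imp_group[OF P(1)] .
  next
    fix g Y assume "g \<in> carrier ?P" "Y \<in> X"
    then show "lam g ` Y \<in> X" using img lamV PC by (auto simp: X_def)
  next
    fix Y assume "Y \<in> X"
    then obtain x where x: "x \<in> V" "Y = U #> x" by (auto simp: X_def)
    then show "lam \<one>\<^bsub>?P\<^esub> ` Y = Y" using img[of \<one> x] VC by (simp add: one_eq subset_iff)
  next
    fix g h Y assume gh: "g \<in> carrier ?P" "h \<in> carrier ?P" and "Y \<in> X"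
    then obtain x where x: "x \<in> V" "Y = U #> x" by (auto simp: X_def)
    have "g \<in> carrier N" "h \<in> carrier N" using gh PC by auto
    then show "lam (g \<otimes>\<^bsub>?P\<^esub> h) ` Y = lam g ` lam h ` Y"
      using x VC img lamV lam_circ[of g h x] by (simp add: subset_iff)
  qed
  have U1: "U = U #> \<one>" using UC by simp
  have oneV: "\<one> \<in> V" using subgroup.one_closed[OF V(1)] .
  have UX: "U \<in> X" using U1 oneV unfolding X_def by blast
  have "\<exists>Y\<in>X. Y \<noteq> U \<and> (\<forall>g\<in>carrier ?P. restrict ((`) (lam g)) X Y = Y)"
  proof (rule act.prime_power_second_fixed_point[OF p])
    show "order ?P = p ^ a" using P(2) by (simp add: order_def)
    show "finite X" using finV by (simp add: X_def)
    show "restrict ((`) (lam g)) X U = U" if "g \<in> carrier ?P" for g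
      using img[of g \<one>] oneV PC[of g] that UX U1 by simp
  qed (use pX UX in auto)
  then obtain x where x: "x \<in> V" "U #> x \<noteq> U" "\<And>g. g \<in> P \<Longrightarrow> lam g ` (U #> x) = U #> x"
    by (auto simp: X_def)
  have xc: "x \<in> carrier N" using x(1) VC by blast
  \<comment> \<open>Inside \<open>V\<close>, membership in \<open>K\<close> and in \<open>U\<close>
    coincide.\<close>
  have "x \<notin> K" using x(1,2) coset_join2[OF xc U] by (auto simp: U_def)
  moreover have "lam g x \<otimes> inv x \<in> K" if g: "g \<in> P" for g
  proof -
    have "U #> lam g x = U #> x" using img[OF PC[OF g] x(1)] x(3)[OF g] by simp
    then show ?thesis
      using subgroup.r_coset_eq_iff[OF U is_group _ xc, of "lam g x"] PC[OF g] xc by (simp add: U_def)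
  qed
  ultimately show ?thesis using x(1) by blast
qed

text \<open>The preimage \<open>E\<close> of the centre of \<open>N\<close> modulo \<open>K\<close>
  is not inside \<open>K\<close>, so neither is some \<open>T p \<inter> E\<close>. There
  \<open>T p\<close> fixes the coset of some \<open>x\<close> outside \<open>K\<close>, and the
  Sylow subgroups for other primes fix \<open>x\<close> itself; hence all of \<open>G\<close> fixes
  the coset of \<open>x\<close>.\<close>

lemma central_over_proper:
  assumes nilN: "nilpotent_group N" and nilG: "nilpotent_group G" and fin: "finite (carrier N)"
    and K: "strong_left_ideal K" and "K \<noteq> carrier N"
  shows "\<not> central_over K \<subseteq> K"
proof -
  have nK: "K \<lhd> N" and lamK: "\<And>g x. g \<in> carrier N \<Longrightarrow> x \<in> K \<Longrightarrow> lam g x \<in> K"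
    using K by (auto simp: strong_left_ideal_def)
  have sK: "subgroup K N" using nK by (rule normal_imp_subgroup)
  define E where "E = {x \<in> carrier N. \<forall>m\<in>carrier N. m \<otimes> x \<otimes> inv m \<otimes> inv x \<in> K}"
  have E: "subgroup E N" unfolding E_def by (rule normal.centralizer_mod_subgroup[OF nK])
  have EC: "E \<subseteq> carrier N" by (auto simp: E_def)
  have EK: "\<not> E \<subseteq> K" using nilpotent_center_mod[OF nilN sK assms(5)] by (auto simp: E_def)
  have lamE: "lam g x \<in> E" if g: "g \<in> carrier N" and x: "x \<in> E" for g x
  proof -
    have xc: "x \<in> carrier N" using x EC by blast
    have "m \<otimes> lam g x \<otimes> inv m \<otimes> inv (lam g x) \<in> K" if m: "m \<in> carrier N" for m
    proof -
      define l where "l = lam (inv\<^bsub>G\<^esub> g) m"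
      have l: "l \<in> carrier N" and ml: "m = lam g l" using g m by (simp_all add: l_def)
      have "lam g (l \<otimes> x \<otimes> inv l \<otimes> inv x) \<in> K" using x l g by (intro lamK) (auto simp: E_def)
      then show ?thesis using g l xc by (simp add: ml lam_mult lam_inv)
    qed
    then show ?thesis using g xc by (simp add: E_def)
  qed
  obtain T where T: "\<And>p. prime p \<Longrightarrow> subgroup (T p) N"
    "\<And>p. prime p \<Longrightarrow> card (T p) = p ^ multiplicity p (order N)"
    using Sylow_subgroup_exists[OF fin] by metis
  \<comment> \<open>Otherwise \<open>E \<inter> K\<close> would contain a Sylow subgroup of
    \<open>E\<close> for each prime and thus be all of \<open>E\<close>.\<close>
  have "\<exists>p. prime p \<and> \<not> T p \<inter> E \<subseteq> K"
  proof (rule ccontr)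
    assume no: "\<not> ?thesis"
    let ?E = "N\<lparr>carrier := E\<rparr>"
    interpret E: group ?E using E subgroup_imp_group by blast
    have finE: "finite (carrier ?E)" using EC fin finite_subset by auto
    have "E \<inter> K = carrier ?E"
    proof (rule E.subgroup_eq_carrier_if_prime_powers[OF finE])
      show "subgroup (E \<inter> K) ?E"
        using subgroup_incl[OF subgroups_Inter_pair[OF E sK] E] by blast
      fix p :: nat assume p: "prime p"
      obtain P where P: "subgroup P ?E" "card P = p ^ multiplicity p (order ?E)"
        using E.Sylow_subgroup_exists[OF finE p] by blast
      have PN: "subgroup P N" using incl_subgroup[OF E P(1)] .
      have PE: "P \<subseteq> E" using subgroup.subset[OF P(1)] by simp
      have "order ?E dvd order N" using lagrange[OF E] by (simp add: order_def) (metis dvd_triv_right)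
      moreover have "order N \<noteq> 0" using fin order_gt_0_iff_finite by auto
      ultimately have "card P dvd card (T p)"
        unfolding P(2) T(2)[OF p] by (intro le_imp_power_dvd dvd_imp_multiplicity_le)
      have "P \<subseteq> T p"
      proof
        fix x assume x: "x \<in> P"
        have xc: "x \<in> carrier N" using subgroup.mem_carrier[OF PN x] .
        have "x [^] card (T p) = \<one>"
          using nat_pow_card_subgroup[OF PN x] \<open>card P dvd card (T p)\<close> pow_eq_id[OF xc] dvd_trans by blast
        then show "x \<in> T p"
          using Sylow_subgroup_normal(2)[OF nilN fin p T(1)[OF p] T(2)[OF p] xc] by blast
      qed
      then have "P \<subseteq> E \<inter> K" using no p PE by blast
      then show "\<exists>P\<subseteq>E \<inter> K. subgroup P ?E \<and> card P = p ^ multiplicity p (order ?E)"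
        using P by blast
    qed
    then show False using EK by auto
  qed
  then obtain p where p: "prime p" "\<not> T p \<inter> E \<subseteq> K" by blast
  have sT: "strong_left_ideal (T q)" if "prime q" for q
    using Sylow_strong_left_ideal[OF nilN fin that T(1)[OF that] T(2)[OF that]] .
  have TG: "subgroup (T q) G" if "prime q" for q using strong_left_ideal_circ_subgroup[OF sT[OF that]] .
  have V: "subgroup (T p \<inter> E) N" using subgroups_Inter_pair[OF T(1)[OF p(1)] E] .
  interpret Tp: group "N\<lparr>carrier := T p\<rparr>" using T(1)[OF p(1)] subgroup_imp_group by blast
  have "card (T p \<inter> E) dvd p ^ multiplicity p (order N)"
    using Tp.lagrange[OF subgroup_incl[OF V T(1)[OF p(1)]]] T(2)[OF p(1)]
    by (simp add: order_def) (metis dvd_triv_right)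
  then obtain b where b: "card (T p \<inter> E) = p ^ b" using p(1) divides_primepow_nat by blast
  have lamV: "lam g x \<in> T p \<inter> E" if "g \<in> carrier N" "x \<in> T p \<inter> E" for g x
    using lamE[OF that(1)] sT[OF p(1)] that by (auto simp: strong_left_ideal_def)
  obtain x where x: "x \<in> T p \<inter> E - K" "\<And>g. g \<in> T p \<Longrightarrow> lam g x \<otimes> inv x \<in> K"
    using prime_power_fixed_coset[OF p(1) TG[OF p(1)] T(2)[OF p(1)] V b lamV K p(2)] by blast
  have xc: "x \<in> carrier N" using x(1) EC by blast
  \<comment> \<open>The stabilizer in \<open>G\<close> of the coset of \<open>x\<close> modulo
    \<open>K\<close>; it only has to contain a Sylow subgroup of \<open>G\<close> for each
    prime.\<close>
  define S where "S = {g \<in> carrier N. lam g x \<otimes> inv x \<in> K}"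
  have S: "subgroup S G"
  proof (rule G.subgroupI)
    show "S \<subseteq> carrier G" by (auto simp: S_def)
    have "\<one> \<in> S" using xc subgroup.one_closed[OF sK] by (simp add: S_def)
    then show "S \<noteq> {}" by blast
  next
    fix a assume "a \<in> S"
    then have a: "a \<in> carrier N" "lam a x \<otimes> inv x \<in> K" by (auto simp: S_def)
    have "lam (inv\<^bsub>G\<^esub> a) (inv (lam a x \<otimes> inv x)) \<in> K"
      using a by (intro lamK subgroup.m_inv_closed[OF sK]) auto
    then show "inv\<^bsub>G\<^esub> a \<in> S" using a(1) xc by (simp add: S_def lam_mult lam_inv inv_mult_group)
  next
    fix a b assume "a \<in> S" "b \<in> S"
    then have ab: "a \<in> carrier N" "b \<in> carrier N" "lam a x \<otimes> inv x \<in> K" "lam b x \<otimes> inv x \<in> K"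
      by (auto simp: S_def)
    \<comment> \<open>The product telescopes: \<open>inv (lam a x)\<close> from the first factor
      cancels \<open>lam a x\<close> in the second.\<close>
    have "lam a (lam b x \<otimes> inv x) \<otimes> (lam a x \<otimes> inv x) \<in> K"
      using subgroup.m_closed[OF sK lamK[OF ab(1,4)] ab(3)] .
    then show "a \<otimes>\<^bsub>G\<^esub> b \<in> S"
      using ab(1,2) xc by (simp add: S_def lam_circ lam_mult lam_inv m_assoc inv_cancel_left)
  qed
  have "S = carrier G"
  proof (rule G.subgroup_eq_carrier_if_prime_powers[OF _ S])
    fix q :: nat assume q: "prime q"
    have TqN: "g \<in> carrier N" if "g \<in> T q" for g using subgroup.mem_carrier[OF T(1)[OF q] that] .
    have "T q \<subseteq> S"
    proof (cases "q = p")
      case True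
      then show ?thesis using x(2) TqN by (auto simp: S_def)
    next
      case False
      have "lam g x = x" if "g \<in> T q" for g
        using lam_trivial_between_Sylow[OF nilN nilG fin q T(1)[OF q] T(2)[OF q] p(1) T(1)[OF p(1)] T(2)[OF p(1)]
            False that, of x] x(1) by blast
      then show ?thesis using TqN xc subgroup.one_closed[OF sK] by (auto simp: S_def)
    qed
    then show "\<exists>P\<subseteq>S. subgroup P G \<and> card P = q ^ multiplicity q (order G)"
      using TG[OF q] T(2)[OF q] order_circ by auto
  qed (use fin in simp)
  then have "x \<in> central_over K" using x(1) by (auto simp: central_over_def E_def S_def)
  then show ?thesis using x(1) by blast
qed

text \<open>While the carrier is not reached each term is strictly larger than the one before, so
  term \<open>n\<close> has at least \<open>n\<close> elements; finiteness stops this.\<close>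

lemma upper_series_eq_carrier_if_nilpotent:
  assumes nilN: "nilpotent_group N" and nilG: "nilpotent_group G" and fin: "finite (carrier N)"
  shows "\<exists>c. upper_series c = carrier N"
proof (rule ccontr)
  assume no: "\<not> ?thesis"
  have fin': "finite (upper_series n)" for n
    using finite_subset[OF subgroup.subset[OF subgroup_upper_series] fin] .
  have "n \<le> card (upper_series n)" for n
  proof (induction n)
    case (Suc n)
    have "\<not> upper_series (Suc n) \<subseteq> upper_series n"
      using central_over_proper[OF nilN nilG fin strong_left_ideal_upper_series] no by simp
    then have "upper_series n \<subset> upper_series (Suc n)" using upper_series_mono[of n "Suc n"] by auto
    then have "card (upper_series n) < card (upper_series (Suc n))" by (rule psubset_card_mono[OF fin'])
    then show ?case using Suc by simp
  qed simp
  moreover have "card (upper_series n) \<le> card (carrier N)" for n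
    using card_mono[OF fin subgroup.subset[OF subgroup_upper_series]] .
  ultimately have "Suc (card (carrier N)) \<le> card (carrier N)" using le_trans by blast
  then show False by simp
qed

end

section \<open>Translation to the ring record of the skew left brace\<close>

theorem theorem4p8:
  fixes A :: "('a, 'b) ring_scheme"
  assumes "skew_left_brace A"
    and "finite (carrier A)"
    and "nilpotent_group (add_monoid A)"
  shows "left_nilpotent A \<longleftrightarrow> nilpotent_group A"
proof -
  interpret A: skew_left_brace A by fact
  interpret B: skew_brace_groups "add_monoid A" A
  proof (intro skew_brace_groups.intro skew_brace_groups_axioms.intro)
    show "group (add_monoid A)" by (rule A.add.is_group)
    show "group A" by (rule A.mul.is_group)
    show "carrier A = carrier (add_monoid A)" by simp
    show "a \<otimes>\<^bsub>A\<^esub> (b \<otimes>\<^bsub>add_monoid A\<^esub> c) =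
        a \<otimes>\<^bsub>A\<^esub> b \<otimes>\<^bsub>add_monoid A\<^esub> inv\<^bsub>add_monoid A\<^esub> a \<otimes>\<^bsub>add_monoid A\<^esub> (a \<otimes>\<^bsub>A\<^esub> c)"
      if "a \<in> carrier (add_monoid A)" "b \<in> carrier (add_monoid A)" "c \<in> carrier (add_monoid A)" for a b c
      using A.brace_distrib[of a b c] that unfolding a_inv_def by simp
  qed
  note B.carrier_eq [simp del] \<comment> \<open>loops here, since \<open>carrier (add_monoid A)\<close> simplifies to \<open>carrier A\<close>\<close>
  have star: "B.lam a b \<otimes>\<^bsub>add_monoid A\<^esub> inv\<^bsub>add_monoid A\<^esub> b = brace_star A a b" for a b
    by (simp add: B.lam_def brace_star_def a_inv_def)
  \<comment> \<open>By \<open>star\<close> the generators agree, and both series start with the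
    carrier at index 0.\<close>
  have series: "left_series A n = B.star_series n" for n
    by (induction n) (simp_all add: brace_star_set_def flip: star)
  have left: "left_nilpotent A \<longleftrightarrow> (\<exists>n. B.star_series n = {\<one>\<^bsub>add_monoid A\<^esub>})"
    by (simp add: left_nilpotent_def series)
  show ?thesis
  proof
    assume "left_nilpotent A"
    then show "nilpotent_group A"
      using left B.upper_series_eq_carrier_if_left_nilpotent assms(3)
        B.nilpotent_circ_if_upper_series_eq_carrier by blast
  next
    assume "nilpotent_group A"
    then show "left_nilpotent A"
      using left B.upper_series_eq_carrier_if_nilpotent assms(2,3)
        B.left_nilpotent_if_upper_series_eq_carrier by fastforce
  qed
qed

end
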